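(* Fix $s\in\mathbb{Q}$, and let $P_s(x)$, $u,v,L,C,F$, $R_1,R_0$ be as in the context. The following are equivalent: (1) $P_s(x)$ admits a $2+3$ factorization over $\mathbb{Q}$; (2) there exist $a,b\in\mathbb{Q}$ such that $R_1(s,a,b)=R_0(s,a,b)=0$. Moreover, if $a,b\in\mathbb{Q}$ satisfy $R_1(s,a,b)=R_0(s,a,b)=0$, then either (A) $L(s,a)\neq 0$ and $F(s,a)=0$, in which case necessarily $b=C(s,a)/L(s,a)$; or (B) $L(s,a)=0$ and $C(s,a)=0$.
   Context: For $s\in\mathbb{Q}$, $P_s(x)\in\mathbb{Q}[x]$ is the monic quintic \[ \begin{aligned} P_s(x)={}&x^{5}+(2+s)(3-2s)x^{4}+(1+10s+4s^{2}-14s^{3}+s^{4})x^{3}\\ &-s(1-14s+4s^{2}+10s^{3}+s^{4})x^{2}-s^{3}(1+2s)(-2+3s)x-s^{5}. \end{aligned} \] A monic quintic $P(x)\in K[x]$ over a field $K$ of characteristic $0$ admits a $2+3$ factorization over $K$ if it is divisible in $K[x]$ by a polynomial of degree $2$ (equivalently $P=DH$ with $\deg D=2$, $\deg H=3$ in $K[x]$). Define polynomials in $\mathbb{Z}[s,a]$: \[ \begin{aligned} u={}&-3a^{2}+(12-4s^{2}-2s)a+(-s^{4}+14s^{3}-4s^{2}-10s-1),\\ v={}&a^{4}+(2s^{2}+s-6)a^{3}+(s^{4}-14s^{3}+4s^{2}+10s+1)a^{2}\\ &+(s^{5}+10s^{4}+4s^{3}-14s^{2}+s)a+(-6s^{5}+s^{4}+2s^{3}),\\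 m={}&-2a-2s^{2}-s+6,\\ n={}&a^{3}+(2s^{2}+s-6)a^{2}+(s^{4}-14s^{3}+4s^{2}+10s+1)a+(s^{5}+10s^{4}+4s^{3}-14s^{2}+s), \end{aligned} \] and $L=n-mu$, $C=mv+s^5$, $F=C^2+uLC+vL^2$. Set \[ R_1(s,a,b)=b^2+u(s,a)b+v(s,a),\qquad R_0(s,a,b)=m(s,a)b^2+n(s,a)b-s^5 . \] The polynomial $R_1(s,a,b)x+R_0(s,a,b)$ is the remainder of the Euclidean division of $P_s(x)$ by $x^2+ax+b$. *)

theory Defs
  imports Complex_Main "HOL-Computational_Algebra.Polynomial"
begin

(* Coefficients are listed from the constant term upwards. *)
definition P :: "rat \<Rightarrow> rat poly" where
  "P s = [: - (s^5),
            - (s^3 * (1 + 2*s) * (-2 + 3*s)),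
            - (s * (1 - 14*s + 4*s^2 + 10*s^3 + s^4)),
            1 + 10*s + 4*s^2 - 14*s^3 + s^4,
            (2 + s) * (3 - 2*s),
            1 :]"

(* Intended for monic quintics only; divisibility is in K[x], where K is the coefficient type,
   and the cofactor of a quadratic divisor of a quintic automatically has degree 3. *)
definition admits_2_3_factorization :: "'a::field_char_0 poly \<Rightarrow> bool" where
  "admits_2_3_factorization p \<longleftrightarrow> (\<exists>D. degree D = 2 \<and> D dvd p)"

(* The bivariate integer polynomials u, v, m, n, L, C, F enter only through their values at
   rational points (s, a), so they are represented by their evaluation functions. *)
definition u_fun :: "rat \<Rightarrow> rat \<Rightarrow> rat" where
  "u_fun s a = -3 * a^2 + (12 - 4*s^2 - 2*s) * a + (- (s^4) + 14*s^3 - 4*s^2 - 10*s - 1)"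

definition v_fun :: "rat \<Rightarrow> rat \<Rightarrow> rat" where
  "v_fun s a = a^4 + (2*s^2 + s - 6) * a^3 + (s^4 - 14*s^3 + 4*s^2 + 10*s + 1) * a^2
     + (s^5 + 10*s^4 + 4*s^3 - 14*s^2 + s) * a + (-6 * s^5 + s^4 + 2*s^3)"

definition m_fun :: "rat \<Rightarrow> rat \<Rightarrow> rat" where
  "m_fun s a = -2 * a - 2*s^2 - s + 6"

definition n_fun :: "rat \<Rightarrow> rat \<Rightarrow> rat" where
  "n_fun s a = a^3 + (2*s^2 + s - 6) * a^2 + (s^4 - 14*s^3 + 4*s^2 + 10*s + 1) * a
     + (s^5 + 10*s^4 + 4*s^3 - 14*s^2 + s)"

definition L_fun :: "rat \<Rightarrow> rat \<Rightarrow> rat" where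
  "L_fun s a = n_fun s a - m_fun s a * u_fun s a"

definition C_fun :: "rat \<Rightarrow> rat \<Rightarrow> rat" where
  "C_fun s a = m_fun s a * v_fun s a + s^5"

definition F_fun :: "rat \<Rightarrow> rat \<Rightarrow> rat" where
  "F_fun s a = (C_fun s a)^2 + u_fun s a * L_fun s a * C_fun s a + v_fun s a * (L_fun s a)^2"

definition R1 :: "rat \<Rightarrow> rat \<Rightarrow> rat \<Rightarrow> rat" where
  "R1 s a b = b^2 + u_fun s a * b + v_fun s a"

definition R0 :: "rat \<Rightarrow> rat \<Rightarrow> rat \<Rightarrow> rat" where
  "R0 s a b = m_fun s a * b^2 + n_fun s a * b - s^5"

end

theory Submission
  imports Defs
begin

text \<open>Division by a monic quadratic \<open>x\<^sup>2 + a x + b\<close> turns divisibility into the vanishing of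
  \<open>R1\<close> and \<open>R0\<close>. Eliminating \<open>b\<^sup>2\<close> between the two remainders gives \<open>R0 - m R1 = L b - C\<close>, so
  \<open>L b = C\<close> at a common zero; multiplying \<open>R1 = 0\<close> by \<open>L\<^sup>2\<close> then yields \<open>F = 0\<close>.\<close>

text \<open>The cubic factor is the quotient of long division: each coefficient below the leading
  one is the matching coefficient of \<open>P s\<close> minus \<open>a\<close> and \<open>b\<close>
  times the quotient coefficients already found.\<close>

lemma P_division:
  "P s = [:b, a, 1:] * [:- (s * (1 - 14*s + 4*s^2 + 10*s^3 + s^4))
             - a * (1 + 10*s + 4*s^2 - 14*s^3 + s^4 - b - a * ((2 + s) * (3 - 2*s) - a))
             - b * ((2 + s) * (3 - 2*s) - a),
           1 + 10*s + 4*s^2 - 14*s^3 + s^4 - b - a * ((2 + s) * (3 - 2*s) - a),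
           (2 + s) * (3 - 2*s) - a, 1:] + [:R0 s a b, R1 s a b:]"
  unfolding P_def R0_def R1_def u_fun_def v_fun_def m_fun_def n_fun_def
  by (simp, intro conjI; algebra)

lemma quadratic_dvd_P_iff: "[:b, a, 1:] dvd P s \<longleftrightarrow> R1 s a b = 0 \<and> R0 s a b = 0"
proof -
  have "[:b, a, 1:] dvd P s \<longleftrightarrow> [:b, a, 1:] dvd [:R0 s a b, R1 s a b:]"
    by (subst P_division[of s b a]) (rule dvd_add_right_iff, rule dvd_triv_left)
  also have "\<dots> \<longleftrightarrow> [:R0 s a b, R1 s a b:] = 0"
  proof
    assume "[:b, a, 1:] dvd [:R0 s a b, R1 s a b:]"
    \<comment> \<open>A nonzero multiple of the quadratic would have degree at least 2.\<close>
    moreover have "degree [:R0 s a b, R1 s a b:] < degree [:b, a, 1:]"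
      by simp
    ultimately show "[:R0 s a b, R1 s a b:] = 0"
      using dvd_imp_degree_le leD by blast
  qed simp
  finally show ?thesis
    by auto
qed

lemma degree_2_poly_eq_smult_monic:
  fixes D :: "'a::field poly"
  assumes "degree D = 2"
  obtains c a b where "c \<noteq> 0" "D = smult c [:b, a, 1:]"
proof
  show "coeff D 2 \<noteq> 0"
    using assms by (metis degree_0 leading_coeff_neq_0 zero_neq_numeral)
  moreover have "D = [:coeff D 0, coeff D 1, coeff D 2:]"
    using assms
    by (intro poly_eqI) (auto simp: coeff_pCons coeff_eq_0 numeral_2_eq_2 split: nat.split)
  ultimately show "D = smult (coeff D 2) [:coeff D 0 / coeff D 2, coeff D 1 / coeff D 2, 1:]"
    by simp
qed

text \<open>Over a field the leading coefficient of a divisor is a unit, so scaling it to 1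
  preserves divisibility.\<close>

lemma admits_2_3_factorization_iff_monic:
  "admits_2_3_factorization p \<longleftrightarrow> (\<exists>a b. [:b, a, 1:] dvd p)"
proof
  assume "admits_2_3_factorization p"
  then obtain D where D: "degree D = 2" "D dvd p"
    unfolding admits_2_3_factorization_def by blast
  from D(1) obtain c a b where "c \<noteq> 0" "D = smult c [:b, a, 1:]"
    by (rule degree_2_poly_eq_smult_monic)
  with D(2) show "\<exists>a b. [:b, a, 1:] dvd p"
    using smult_dvd_iff by metis
next
  assume "\<exists>a b. [:b, a, 1:] dvd p"
  then obtain a b where "[:b, a, 1:] dvd p"
    by blast
  moreover have "degree [:b, a, 1:] = 2"
    by simp
  ultimately show "admits_2_3_factorization p"
    unfolding admits_2_3_factorization_def by blast
qed

lemma common_zero_L_C: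
  assumes "R1 s a b = 0" "R0 s a b = 0"
  shows "L_fun s a * b = C_fun s a"
  using assms unfolding R1_def R0_def L_fun_def C_fun_def by algebra

text \<open>Substituting \<open>L b = C\<close> into \<open>L^2 R1\<close> gives \<open>F\<close>
  without dividing by \<open>L\<close>, so the case \<open>L = 0\<close> is covered too.\<close>

lemma common_zero_F:
  assumes "R1 s a b = 0" "R0 s a b = 0"
  shows "F_fun s a = 0"
  using assms(1) common_zero_L_C[OF assms] unfolding R1_def F_fun_def by algebra

theorem proposition1:
  fixes s :: rat
  shows "(admits_2_3_factorization (P s) \<longleftrightarrow> (\<exists>a b. R1 s a b = 0 \<and> R0 s a b = 0))
    \<and> (\<forall>a b. R1 s a b = 0 \<and> R0 s a b = 0 \<longrightarrow>
          (L_fun s a \<noteq> 0 \<and> F_fun s a = 0 \<and> b = C_fun s a / L_fun s a)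
        \<or> (L_fun s a = 0 \<and> C_fun s a = 0))"
proof (intro conjI allI impI)
  show "admits_2_3_factorization (P s) \<longleftrightarrow> (\<exists>a b. R1 s a b = 0 \<and> R0 s a b = 0)"
    by (simp only: admits_2_3_factorization_iff_monic quadratic_dvd_P_iff)
next
  fix a b
  assume "R1 s a b = 0 \<and> R0 s a b = 0"
  then have "L_fun s a * b = C_fun s a" "F_fun s a = 0"
    using common_zero_L_C common_zero_F by auto
  then show "(L_fun s a \<noteq> 0 \<and> F_fun s a = 0 \<and> b = C_fun s a / L_fun s a)
      \<or> (L_fun s a = 0 \<and> C_fun s a = 0)"
    \<comment> \<open>If \<open>L = 0\<close>, then \<open>L b = C\<close> forces
      \<open>C = 0\<close>; otherwise it can be solved for \<open>b\<close>.\<close>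
    by (cases "L_fun s a = 0") (auto simp: field_simps)
qed

end
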